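(* Let $\mathfrak{M}=\{\mathcal{M}_{\mathbf{w},s}: n=1,2,\dots,\ \mathbf{w}\in\mathbb{R}^n,\ s\in\mathbb{R}\}$ be the collection of all generalized weighted majority events. Then $\mathfrak{M}$ is uniformly stable. Moreover, there is a universal constant $C$ such that for every $\mathcal{M}\in\mathfrak{M}$ and every $\epsilon\in(0,1)$, $$\mathbf{P}[\mathcal{M}-N_\epsilon\mathcal{M}]\le C\epsilon^{1/4}.$$
   Context: $\Omega_n=\{0,1\}^n$ carries the uniform probability measure $\mathbf{P}$. For $\mathbf{w}\in\mathbb{R}^n$ and $s\in\mathbb{R}$, $$\mathcal{M}_{\mathbf{w},s}=\Bigl\{x\in\Omega_n:\sum_{j=1}^n(2x_j-1)w_j>s\Bigr\}\subset\Omega_n.$$ Noise: for $x\in\Omega_n$ and $\epsilon\in(0,1)$, $N_\epsilon(x)$ is the random element of $\Omega_n$ whose coordinates are, independently, $x_j$ with probability $1-\epsilon$ and $1-x_j$ with probability $\epsilon$. Let $x\in\Omega_n$ be uniformly random. For $\mathcal{A}\subset\Omega_n$, $N_\epsilon\mathcal{A}$ denotes the event $N_\epsilon(x)\in\mathcal{A}$, while $\mathcal{A}$ itself denotes the event $x\in\mathcal{A}$; thus $\mathbf{P}[\mathcal{A}-N_\epsilon\mathcal{A}]=\mathbf{P}[x\in\mathcal{A},\,N_\epsilon(x)\notin\mathcal{A}]$, and $\mathbf{P}[\mathcal{A}\triangle N_\epsilon\mathcal{A}]$ is the probability that exactly one of $x\in\mathcal{A}$, $N_\epsilon(x)\in\mathcal{A}$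 holds. A collection of events $\{\mathcal{A}_i\}$, $\mathcal{A}_i\subset\Omega_{n_i}$, is uniformly stable if the limit $\lim_{\epsilon\to0}\mathbf{P}[\mathcal{A}_i\triangle N_\epsilon\mathcal{A}_i]=0$ is uniform in $i$. *)

theory Defs
  imports "HOL-Probability.Probability"
begin

text \<open>A point of the cube $\{0,1\}^n$ is a function on \<open>nat\<close> whose coordinates \<open>j < n\<close> are
  arbitrary bits (\<open>True\<close> is 1) and whose other coordinates are fixed to \<open>False\<close>, the default value
  also used by \<open>Pi_pmf\<close>.\<close>

definition cube :: "nat \<Rightarrow> (nat \<Rightarrow> bool) set" where
  "cube n = PiE_dflt {..<n} False (\<lambda>_. UNIV)"

lemma finite_cube: "finite (cube n)"
  unfolding cube_def by (intro finite_PiE_dflt) auto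

lemma cube_nonempty: "cube n \<noteq> {}"
proof -
  have "(\<lambda>_. False) \<in> cube n"
    by (simp add: cube_def PiE_dflt_def)
  then show ?thesis by blast
qed

definition noise :: "nat \<Rightarrow> real \<Rightarrow> (nat \<Rightarrow> bool) \<Rightarrow> (nat \<Rightarrow> bool) pmf" where
  "noise n \<epsilon> x =
     Pi_pmf {..<n} False
       (\<lambda>j. map_pmf (\<lambda>flip. if flip then \<not> x j else x j) (bernoulli_pmf \<epsilon>))"

text \<open>The joint law of a uniformly random point \<open>x\<close> and its noisy version.\<close>

definition noisy_pair :: "nat \<Rightarrow> real \<Rightarrow> ((nat \<Rightarrow> bool) \<times> (nat \<Rightarrow> bool)) pmf" where
  "noisy_pair n \<epsilon> =
     bind_pmf (pmf_of_set (cube n)) (\<lambda>x. map_pmf (\<lambda>y. (x, y)) (noise n \<epsilon> x))"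

definition prob_diff_noise :: "nat \<Rightarrow> real \<Rightarrow> (nat \<Rightarrow> bool) set \<Rightarrow> real" where
  "prob_diff_noise n \<epsilon> A =
     measure_pmf.prob (noisy_pair n \<epsilon>) {(x, y). x \<in> A \<and> y \<notin> A}"

definition prob_sym_diff_noise :: "nat \<Rightarrow> real \<Rightarrow> (nat \<Rightarrow> bool) set \<Rightarrow> real" where
  "prob_sym_diff_noise n \<epsilon> A =
     measure_pmf.prob (noisy_pair n \<epsilon>) {(x, y). (x \<in> A) \<noteq> (y \<in> A)}"

text \<open>An event is paired with the dimension of the cube it lives in.  The noise level ranges over
  $(0,1)$, so the limit at 0 is one-sided.\<close>

definition uniformly_stable :: "(nat \<times> (nat \<Rightarrow> bool) set) set \<Rightarrow> bool" where
  "uniformly_stable \<A> \<longleftrightarrow>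
     uniform_limit \<A> (\<lambda>\<epsilon> (n, A). prob_sym_diff_noise n \<epsilon> A) (\<lambda>_. 0) (at_right 0)"

text \<open>Only the weights \<open>w j\<close> with \<open>j < n\<close> matter, so \<open>w\<close> represents a vector in $R^n$.\<close>

definition weighted_majority :: "nat \<Rightarrow> (nat \<Rightarrow> real) \<Rightarrow> real \<Rightarrow> (nat \<Rightarrow> bool) set" where
  "weighted_majority n w s = {x \<in> cube n. (\<Sum>j<n. (2 * of_bool (x j) - 1) * w j) > s}"

definition weighted_majorities :: "(nat \<times> (nat \<Rightarrow> bool) set) set" where
  "weighted_majorities = {(n, weighted_majority n w s) | n w s. n \<ge> 1}"

end

theory Submission
  imports Defs
begin

text \<open>The argument is that of Peres and gives the stronger exponent 1/2.  Let \<open>m\<close> be the integer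
  part of \<open>1 / \<epsilon>\<close> and give the coordinates independent random labels so that each of \<open>m\<close> labels has
  probability \<open>\<epsilon>\<close>, the remaining probability going to an extra label.  For each \<open>i < m\<close> the set of
  coordinates with label \<open>i\<close> is distributed as the set of coordinates flipped by the noise.  For
  a fixed labelling, the signs of the \<open>m\<close> block sums are orthogonal functions on the cube, and
  flipping block \<open>i\<close> can only make the point leave the event if the block sum is positive and
  enter it if the block sum is negative.  By Cauchy-Schwarz the average number of blocks whose
  flip is detected is therefore at most of order \<open>sqrt m\<close>, out of \<open>m\<close> blocks.\<close>

text \<open>Pushing forward along membership in \<open>S\<close> turns a probability into a point
  mass at \<open>True\<close>, to which \<open>pmf_bind\<close> applies.\<close>

lemma measure_bind_pmf:
  "measure_pmf.prob (bind_pmf M f) S = (\<integral>x. measure_pmf.prob (f x) S \<partial>measure_pmf M)"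
proof -
  have *: "measure_pmf.prob p S = pmf (map_pmf (\<lambda>x. x \<in> S) p) True" for p
    by (simp add: pmf_map vimage_def)
  show ?thesis
    unfolding * map_bind_pmf pmf_bind ..
qed

section \<open>Orthogonal functions and involutions on a finite set\<close>

text \<open>Orthogonality leaves only the diagonal terms in the second moment of the sum of the
  \<open>t i\<close>; Cauchy-Schwarz against \<open>F\<close> then gives the square root of
  \<open>card I\<close>.\<close>

lemma orthogonal_sum_bound:
  fixes t :: "'i \<Rightarrow> 'a \<Rightarrow> real" and F :: "'a \<Rightarrow> real"
  assumes "finite X" "finite I"
    and t: "\<And>i x. i \<in> I \<Longrightarrow> x \<in> X \<Longrightarrow> \<bar>t i x\<bar> \<le> 1"
    and orth: "\<And>i k. i \<in> I \<Longrightarrow> k \<in> I \<Longrightarrow> i \<noteq> k \<Longrightarrow> (\<Sum>x\<in>X. t i x * t k x) = 0"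
    and F: "\<And>x. x \<in> X \<Longrightarrow> \<bar>F x\<bar> \<le> 1"
  shows "(\<Sum>i\<in>I. \<Sum>x\<in>X. t i x * F x) \<le> sqrt (card I) * card X"
proof (rule power2_le_imp_le)
  have sq: "a\<^sup>2 \<le> 1" if "\<bar>a\<bar> \<le> 1" for a :: real
    using that by (simp add: abs_square_le_1)
  have "(\<Sum>x\<in>X. (\<Sum>i\<in>I. t i x)\<^sup>2) = (\<Sum>x\<in>X. \<Sum>i\<in>I. \<Sum>k\<in>I. t i x * t k x)"
    by (simp add: power2_eq_square sum_product)
  also have "\<dots> = (\<Sum>i\<in>I. \<Sum>x\<in>X. \<Sum>k\<in>I. t i x * t k x)"
    by (rule sum.swap)
  also have "\<dots> = (\<Sum>i\<in>I. \<Sum>k\<in>I. \<Sum>x\<in>X. t i x * t k x)"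
    by (intro sum.cong refl sum.swap)
  also have "\<dots> = (\<Sum>i\<in>I. \<Sum>k\<in>I. if k = i then \<Sum>x\<in>X. (t i x)\<^sup>2 else 0)"
    using orth by (intro sum.cong refl) (auto simp: power2_eq_square)
  also have "\<dots> = (\<Sum>i\<in>I. \<Sum>x\<in>X. (t i x)\<^sup>2)"
    using \<open>finite I\<close> by simp
  also have "\<dots> \<le> (\<Sum>i\<in>I. \<Sum>x\<in>X. 1)"
    using t by (intro sum_mono sq)
  finally have t2: "(\<Sum>x\<in>X. (\<Sum>i\<in>I. t i x)\<^sup>2) \<le> real (card I) * card X"
    by simp
  have "(\<Sum>x\<in>X. (F x)\<^sup>2) \<le> (\<Sum>x\<in>X. 1)"
    using F by (intro sum_mono sq)
  then have F2: "(\<Sum>x\<in>X. (F x)\<^sup>2) \<le> card X"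
    by simp
  have "(\<Sum>i\<in>I. \<Sum>x\<in>X. t i x * F x) = (\<Sum>x\<in>X. (\<Sum>i\<in>I. t i x) * F x)"
    by (subst sum.swap) (simp add: sum_distrib_right)
  then have "(\<Sum>i\<in>I. \<Sum>x\<in>X. t i x * F x)\<^sup>2 \<le> (\<Sum>x\<in>X. (\<Sum>i\<in>I. t i x)\<^sup>2) * (\<Sum>x\<in>X. (F x)\<^sup>2)"
    by (simp only: Cauchy_Schwarz_ineq_sum)
  also have "\<dots> \<le> (real (card I) * card X) * card X"
    using t2 F2 by (intro mult_mono) (auto intro: sum_nonneg)
  also have "\<dots> = (sqrt (card I) * card X)\<^sup>2"
    by (simp add: power_mult_distrib power2_eq_square)
  finally show "(\<Sum>i\<in>I. \<Sum>x\<in>X. t i x * F x)\<^sup>2 \<le> (sqrt (card I) * card X)\<^sup>2" .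
qed simp

text \<open>Both inputs come from reindexing by the involution \<open>\<phi> i\<close>: the product
  \<open>t i x * t k x\<close> is odd under it, hence sums to zero, and
  \<open>F (\<phi> i x)\<close> contributes the same as \<open>- F x\<close>, whence the factor
  2.\<close>

lemma flip_influence_bound:
  fixes t :: "'i \<Rightarrow> 'a \<Rightarrow> real" and F :: "'a \<Rightarrow> real"
  assumes "finite X" "finite I"
    and t: "\<And>i x. i \<in> I \<Longrightarrow> x \<in> X \<Longrightarrow> \<bar>t i x\<bar> \<le> 1"
    and F: "\<And>x. x \<in> X \<Longrightarrow> \<bar>F x\<bar> \<le> 1"
    and \<phi>_in: "\<And>i x. i \<in> I \<Longrightarrow> x \<in> X \<Longrightarrow> \<phi> i x \<in> X"
    and \<phi>_inv: "\<And>i x. i \<in> I \<Longrightarrow> x \<in> X \<Longrightarrow> \<phi> i (\<phi> i x) = x"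
    and t_same: "\<And>i x. i \<in> I \<Longrightarrow> x \<in> X \<Longrightarrow> t i (\<phi> i x) = - t i x"
    and t_other: "\<And>i k x. i \<in> I \<Longrightarrow> k \<in> I \<Longrightarrow> i \<noteq> k \<Longrightarrow> x \<in> X \<Longrightarrow> t k (\<phi> i x) = t k x"
  shows "(\<Sum>i\<in>I. \<Sum>x\<in>X. t i x * (F x - F (\<phi> i x))) \<le> 2 * sqrt (card I) * card X"
proof -
  have reindex: "(\<Sum>x\<in>X. g (\<phi> i x)) = sum g X" if "i \<in> I" for i and g :: "'a \<Rightarrow> real"
    using that \<phi>_in \<phi>_inv by (intro sum.reindex_bij_witness[of _ "\<phi> i" "\<phi> i"]) auto
  have orth: "(\<Sum>x\<in>X. t i x * t k x) = 0" if "i \<in> I" "k \<in> I" "i \<noteq> k" for i k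
  proof -
    have "(\<Sum>x\<in>X. t i x * t k x) = (\<Sum>x\<in>X. t i (\<phi> i x) * t k (\<phi> i x))"
      using reindex[OF \<open>i \<in> I\<close>, of "\<lambda>x. t i x * t k x"] by simp
    also have "\<dots> = (\<Sum>x\<in>X. - (t i x * t k x))"
      using that t_same t_other by (intro sum.cong) auto
    finally show ?thesis by (simp add: sum_negf)
  qed
  have "(\<Sum>x\<in>X. t i x * (F x - F (\<phi> i x))) = 2 * (\<Sum>x\<in>X. t i x * F x)" if "i \<in> I" for i
  proof -
    have "(\<Sum>x\<in>X. t i x * F (\<phi> i x)) = (\<Sum>x\<in>X. - (t i (\<phi> i x) * F (\<phi> i x)))"
      using that t_same by (intro sum.cong) auto
    also have "\<dots> = - (\<Sum>x\<in>X. t i x * F x)"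
      using reindex[OF that, of "\<lambda>x. t i x * F x"] by (simp add: sum_negf)
    finally show ?thesis
      by (simp add: right_diff_distrib sum_subtractf)
  qed
  then have "(\<Sum>i\<in>I. \<Sum>x\<in>X. t i x * (F x - F (\<phi> i x))) = 2 * (\<Sum>i\<in>I. \<Sum>x\<in>X. t i x * F x)"
    by (simp add: sum_distrib_left)
  with orthogonal_sum_bound[OF assms(1,2) t orth F] show ?thesis
    by simp
qed

section \<open>Flipping blocks of coordinates\<close>

text \<open>Bitwise exclusive or, cut off at \<open>n\<close> so that the result lies in the cube
  for every mask \<open>z\<close>.\<close>

definition flip_on :: "nat \<Rightarrow> (nat \<Rightarrow> bool) \<Rightarrow> (nat \<Rightarrow> bool) \<Rightarrow> nat \<Rightarrow> bool" where
  "flip_on n z x = (\<lambda>j. j < n \<and> x j \<noteq> z j)"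

lemma cube_iff: "x \<in> cube n \<longleftrightarrow> (\<forall>j\<ge>n. \<not> x j)"
  by (auto simp: cube_def PiE_dflt_def not_less)

lemma flip_on_in_cube: "flip_on n z x \<in> cube n"
  by (simp add: cube_iff flip_on_def)

lemma flip_on_flip_on: "x \<in> cube n \<Longrightarrow> flip_on n z (flip_on n z x) = x"
proof
  fix j assume "x \<in> cube n"
  then show "flip_on n z (flip_on n z x) j = x j"
    by (cases "j < n") (auto simp: flip_on_def cube_iff)
qed

text \<open>The labelling \<open>b\<close> is fixed and arbitrary; since the bound does not depend
  on it, it survives averaging over random labellings.\<close>

lemma flip_block_count_bound:
  fixes b :: "nat \<Rightarrow> nat"
  assumes A_def: "A = weighted_majority n w s"
  shows "(\<Sum>i<m. real (card {x \<in> cube n. (x \<in> A) \<noteq> (flip_on n (\<lambda>j. b j = i) x \<in> A)}))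
           \<le> 2 * sqrt m * card (cube n)"
proof -
  define \<phi> where "\<phi> i = flip_on n (\<lambda>j. b j = i)" for i
  define u where "u x j = (2 * of_bool (x j) - 1) * w j" for x :: "nat \<Rightarrow> bool" and j
  define a where "a i x = (\<Sum>j<n. if b j = i then u x j else 0)" for i x
  define F :: "(nat \<Rightarrow> bool) \<Rightarrow> real" where "F x = of_bool (x \<in> A)" for x
  have mem: "x \<in> A \<longleftrightarrow> (\<Sum>j<n. u x j) > s" if "x \<in> cube n" for x
    using that by (simp add: A_def weighted_majority_def u_def)
  have \<phi>_in: "\<phi> i x \<in> cube n" for i x
    by (simp add: \<phi>_def flip_on_in_cube)
  have u_flip: "u (\<phi> i x) j = (if b j = i then - u x j else u x j)" if "j < n" for i x j
    using that by (auto simp: u_def \<phi>_def flip_on_def)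
  have a_same: "a i (\<phi> i x) = - a i x" for i x
    unfolding a_def sum_negf[symmetric] by (intro sum.cong) (auto simp: u_flip)
  have a_other: "a k (\<phi> i x) = a k x" if "i \<noteq> k" for i k x
    unfolding a_def using that by (intro sum.cong) (auto simp: u_flip)
  have diff: "(\<Sum>j<n. u x j) - (\<Sum>j<n. u (\<phi> i x) j) = 2 * a i x" for i x
    unfolding a_def sum_subtractf[symmetric] sum_distrib_left
    by (intro sum.cong) (auto simp: u_flip)
  \<comment> \<open>Flipping block \<open>i\<close> lowers the weighted sum by
    \<open>2 * a i x\<close>, so the sign of \<open>a i x\<close> decides whether the point can only
    leave or only enter \<open>A\<close>; if it is zero, membership is unchanged.\<close>
  have detect: "of_bool ((x \<in> A) \<noteq> (\<phi> i x \<in> A)) = sgn (a i x) * (F x - F (\<phi> i x))"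
    if "x \<in> cube n" for i x
    using diff[of x i] mem[OF that] mem[OF \<phi>_in[of i x]]
    by (auto simp: F_def sgn_if)
  have "(\<Sum>i<m. real (card {x \<in> cube n. (x \<in> A) \<noteq> (\<phi> i x \<in> A)}))
      = (\<Sum>i<m. \<Sum>x\<in>cube n. of_bool ((x \<in> A) \<noteq> (\<phi> i x \<in> A)))"
    by (simp add: finite_cube Int_def)
  also have "\<dots> = (\<Sum>i<m. \<Sum>x\<in>cube n. sgn (a i x) * (F x - F (\<phi> i x)))"
    by (intro sum.cong refl detect)
  also have "\<dots> \<le> 2 * sqrt (card {..<m}) * card (cube n)"
    by (rule flip_influence_bound)
       (auto simp: finite_cube \<phi>_in a_same a_other sgn_minus F_def abs_sgn_eq,
        auto simp: \<phi>_def flip_on_flip_on)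
  finally show ?thesis
    by (simp add: \<phi>_def)
qed

section \<open>Noise as a random block of a labelling\<close>

text \<open>This separates the randomness: the law of the flip mask no longer involves
  \<open>x\<close>.\<close>

lemma noise_eq_flip_on:
  assumes "x \<in> cube n"
  shows "noise n \<epsilon> x = map_pmf (\<lambda>z. flip_on n z x) (Pi_pmf {..<n} False (\<lambda>_. bernoulli_pmf \<epsilon>))"
  unfolding noise_def map_pmf_def
  by (subst Pi_pmf_bind[where d' = False])
     (auto simp: flip_on_def fun_eq_iff intro!: bind_pmf_cong)

lemma ex_label_pmf:
  assumes "0 \<le> \<epsilon>" "real m * \<epsilon> \<le> 1"
  shows "\<exists>L::nat pmf. \<forall>i<m. map_pmf (\<lambda>l. l = i) L = bernoulli_pmf \<epsilon>"
proof (cases "m = 0")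
  case False
  \<comment> \<open>Total mass \<open>m * \<epsilon>\<close> is spread evenly over the labels below
    \<open>m\<close>, and the rest goes to the extra label \<open>m\<close>.\<close>
  define L where "L = bind_pmf (bernoulli_pmf (m * \<epsilon>))
    (\<lambda>h. if h then pmf_of_set {..<m} else return_pmf m)"
  have "\<epsilon> \<le> m * \<epsilon>"
    using False assms(1) by (simp add: mult_le_cancel_right1)
  with assms have \<epsilon>: "\<epsilon> \<le> 1" by simp
  have "map_pmf (\<lambda>l. l = i) L = bernoulli_pmf \<epsilon>" if "i < m" for i
  proof -
    have "pmf (map_pmf (\<lambda>l. l = i) L) True = pmf L i"
      by (simp add: pmf_map vimage_def measure_pmf_single)
    also have "\<dots> = \<epsilon>"
      using assms that False by (auto simp: L_def pmf_bind lessThan_empty_iff)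
    finally have True_eq: "pmf (map_pmf (\<lambda>l. l = i) L) True = pmf (bernoulli_pmf \<epsilon>) True"
      using assms \<epsilon> by simp
    show ?thesis
    \<comment> \<open>A distribution on \<open>bool\<close> is determined by its mass at
      \<open>True\<close>.\<close>
    proof (rule pmf_eqI)
      fix c show "pmf (map_pmf (\<lambda>l. l = i) L) c = pmf (bernoulli_pmf \<epsilon>) c"
        using True_eq by (cases c) (simp_all only: pmf_False_conv_True)
    qed
  qed
  then show ?thesis by blast
qed simp

text \<open>All \<open>m\<close> blocks give the same probability, so \<open>m\<close> times it is
  the expected number of blocks whose flip is detected, which is at most
  \<open>2 * sqrt m\<close>.\<close>

lemma prob_sym_diff_noise_le_blocks:
  assumes "0 \<le> \<epsilon>" "real m * \<epsilon> \<le> 1" "0 < m"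
  shows "prob_sym_diff_noise n \<epsilon> (weighted_majority n w s) \<le> 2 / sqrt m"
proof -
  define A where "A = weighted_majority n w s"
  define U where "U = pmf_of_set (cube n)"
  obtain L :: "nat pmf" where L: "\<And>i. i < m \<Longrightarrow> map_pmf (\<lambda>l. l = i) L = bernoulli_pmf \<epsilon>"
    using ex_label_pmf[OF assms(1,2)] by blast
  \<comment> \<open>The default label \<open>m\<close> differs from every \<open>i < m\<close>, so
    testing for label \<open>i\<close> sends it to the default \<open>False\<close>, as
    \<open>Pi_pmf_map\<close> requires.\<close>
  define B where "B = Pi_pmf {..<n} m (\<lambda>_. L)"
  define Q where "Q i b = measure_pmf.prob U {x. (x \<in> A) \<noteq> (flip_on n (\<lambda>j. b j = i) x \<in> A)}"
    for i :: nat and b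
  have noise_eq: "prob_sym_diff_noise n \<epsilon> A = (\<integral>b. Q i b \<partial>measure_pmf B)" if "i < m" for i
  proof -
    have comp_eq: "(\<circ>) (\<lambda>l. l = i) = (\<lambda>b j. b j = i)" for i :: nat
      by (simp add: fun_eq_iff)
    have "Pi_pmf {..<n} False (\<lambda>_. bernoulli_pmf \<epsilon>) = map_pmf (\<lambda>b j. b j = i) B"
      unfolding L[OF that, symmetric] B_def
      using that by (subst Pi_pmf_map[where dflt = m]) (simp_all add: comp_eq)
    then have "noisy_pair n \<epsilon> = bind_pmf U (\<lambda>x. bind_pmf B
        (\<lambda>b. return_pmf (x, flip_on n (\<lambda>j. b j = i) x)))"
      unfolding noisy_pair_def U_def
      by (intro bind_pmf_cong refl)
         (simp add: finite_cube cube_nonempty noise_eq_flip_on map_pmf_def bind_assoc_pmf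
           bind_return_pmf)
    \<comment> \<open>The point and the labelling are independent, so the labelling may be drawn
      first.\<close>
    also have "\<dots> = bind_pmf B (\<lambda>b. map_pmf (\<lambda>x. (x, flip_on n (\<lambda>j. b j = i) x)) U)"
      unfolding map_pmf_def by (rule bind_commute_pmf)
    finally show ?thesis
      by (simp add: prob_sym_diff_noise_def measure_bind_pmf Q_def vimage_def)
  qed
  have Q_int: "integrable (measure_pmf B) (Q i)" for i
    by (auto simp: Q_def intro!: measure_pmf.integrable_const_bound[where B = 1])
  from noise_eq have "(\<Sum>i<m. prob_sym_diff_noise n \<epsilon> A) = (\<Sum>i<m. \<integral>b. Q i b \<partial>measure_pmf B)"
    by (intro sum.cong) auto
  then have "m * prob_sym_diff_noise n \<epsilon> A = (\<Sum>i<m. \<integral>b. Q i b \<partial>measure_pmf B)"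
    by simp
  also have "\<dots> = (\<integral>b. (\<Sum>i<m. Q i b) \<partial>measure_pmf B)"
    by (rule Bochner_Integration.integral_sum[symmetric]) (rule Q_int)
  also have "\<dots> \<le> (\<integral>b. 2 * sqrt m \<partial>measure_pmf B)"
  proof (rule integral_mono)
    show "integrable (measure_pmf B) (\<lambda>b. \<Sum>i<m. Q i b)"
      by (intro Bochner_Integration.integrable_sum Q_int)
    fix b
    have "(\<Sum>i<m. Q i b)
        = (\<Sum>i<m. real (card {x \<in> cube n. (x \<in> A) \<noteq> (flip_on n (\<lambda>j. b j = i) x \<in> A)}))
          / card (cube n)"
      by (simp add: Q_def U_def measure_pmf_of_set cube_nonempty finite_cube Int_def
          sum_divide_distrib)
    also have "\<dots> \<le> 2 * sqrt m"
      using flip_block_count_bound[OF A_def, of b m] cube_nonempty[of n] finite_cube[of n]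
      by (simp add: divide_le_eq card_gt_0_iff)
    finally show "(\<Sum>i<m. Q i b) \<le> 2 * sqrt m" .
  qed simp
  finally have "m * prob_sym_diff_noise n \<epsilon> A \<le> 2 * sqrt m"
    by simp
  moreover have "sqrt m * (sqrt m * prob_sym_diff_noise n \<epsilon> A) = m * prob_sym_diff_noise n \<epsilon> A"
    by (simp flip: mult.assoc)
  ultimately have "sqrt m * (sqrt m * prob_sym_diff_noise n \<epsilon> A) \<le> sqrt m * 2"
    by linarith
  then have "sqrt m * prob_sym_diff_noise n \<epsilon> A \<le> 2"
    using \<open>0 < m\<close> by simp
  then show ?thesis
    using \<open>0 < m\<close> by (simp add: A_def le_divide_eq mult.commute)
qed

text \<open>Taking the largest \<open>m\<close> with \<open>m * \<epsilon> \<le> 1\<close> makes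
  \<open>m * \<epsilon>\<close> at least 1/2, so \<open>2 / sqrt m\<close> has order
  \<open>sqrt \<epsilon>\<close>.\<close>

lemma prob_sym_diff_noise_weighted_majority:
  assumes "0 < \<epsilon>" "\<epsilon> < 1"
  shows "prob_sym_diff_noise n \<epsilon> (weighted_majority n w s) \<le> 3 * sqrt \<epsilon>"
proof -
  define m where "m = nat \<lfloor>1 / \<epsilon>\<rfloor>"
  have ge1: "1 \<le> \<lfloor>1 / \<epsilon>\<rfloor>"
    using assms by (simp add: le_floor_iff)
  then have m_eq: "real m = of_int \<lfloor>1 / \<epsilon>\<rfloor>"
    unfolding m_def by (intro of_nat_nat) linarith
  with ge1 have m: "1 \<le> real m"
    by linarith
  from m_eq have le: "real m \<le> 1 / \<epsilon>" and "1 / \<epsilon> < real m + 1"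
    using of_int_floor_le[of "1 / \<epsilon>"] floor_correct[of "1 / \<epsilon>"] by linarith+
  with m have "1 / \<epsilon> \<le> 2 * real m"
    by linarith
  with assms have ge: "1 \<le> 2 * real m * \<epsilon>"
    by (simp add: pos_divide_le_eq)
  have "prob_sym_diff_noise n \<epsilon> (weighted_majority n w s) \<le> 2 / sqrt m"
    using assms le m by (intro prob_sym_diff_noise_le_blocks) (auto simp: le_divide_eq)
  also have "\<dots> \<le> 3 * sqrt \<epsilon>"
  proof -
    \<comment> \<open>The constant 3 suffices because \<open>9 * (m * \<epsilon>)\<close> is at
      least 9/2, which exceeds 4.\<close>
    have "2 \<le> sqrt (9 * (m * \<epsilon>))"
      using ge by (intro real_le_rsqrt) simp
    then have "2 \<le> 3 * sqrt \<epsilon> * sqrt m"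
      by (simp add: real_sqrt_mult mult_ac)
    then show ?thesis
      using m by (simp add: pos_divide_le_eq)
  qed
  finally show ?thesis .
qed

lemma prob_diff_noise_le: "prob_diff_noise n \<epsilon> A \<le> prob_sym_diff_noise n \<epsilon> A"
  unfolding prob_diff_noise_def prob_sym_diff_noise_def
  by (intro measure_pmf.finite_measure_mono) auto

theorem theorem1p8:
  shows "uniformly_stable weighted_majorities \<and>
    (\<exists>C::real. \<forall>(n, M) \<in> weighted_majorities. \<forall>\<epsilon>\<in>{0<..<1}.
       prob_diff_noise n \<epsilon> M \<le> C * \<epsilon> powr (1/4))"
proof
  show "uniformly_stable weighted_majorities"
    unfolding uniformly_stable_def uniform_limit_iff
  proof (intro allI impI)
    fix e :: real assume "0 < e"
    have "((\<lambda>\<epsilon>. 3 * sqrt \<epsilon>) \<longlongrightarrow> 3 * sqrt 0) (at_right 0)"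
      by (intro tendsto_intros)
    then have "\<forall>\<^sub>F \<epsilon> in at_right 0. 3 * sqrt \<epsilon> < e"
      using \<open>0 < e\<close> by (auto dest: order_tendstoD(2))
    moreover have "\<forall>\<^sub>F \<epsilon> in at_right (0::real). \<epsilon> \<in> {0<..<1}"
      by (rule eventually_at_right_real) simp
    ultimately show "\<forall>\<^sub>F \<epsilon> in at_right 0. \<forall>p\<in>weighted_majorities.
        dist (case p of (n, A) \<Rightarrow> prob_sym_diff_noise n \<epsilon> A) 0 < e"
    proof eventually_elim
      case (elim \<epsilon>)
      \<comment> \<open>The bound \<open>3 * sqrt \<epsilon>\<close> is free of \<open>n\<close>,
        \<open>w\<close> and \<open>s\<close>, which gives uniformity.\<close>
      have "\<bar>prob_sym_diff_noise n \<epsilon> (weighted_majority n w s)\<bar> < e" for n w s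
        using elim prob_sym_diff_noise_weighted_majority[of \<epsilon> n w s]
        by (simp add: prob_sym_diff_noise_def)
      then show ?case
        by (auto simp: weighted_majorities_def)
    qed
  qed
  have "prob_diff_noise n \<epsilon> (weighted_majority n w s) \<le> 3 * \<epsilon> powr (1/4)"
    if "0 < \<epsilon>" "\<epsilon> < 1" for n w s \<epsilon>
  proof -
    \<comment> \<open>Below 1, lowering the exponent from 1/2 to 1/4 only weakens the bound.\<close>
    have "sqrt \<epsilon> \<le> \<epsilon> powr (1/4)"
      using that by (simp add: powr_half_sqrt[symmetric] powr_mono')
    then show ?thesis
      using prob_diff_noise_le[of n \<epsilon> "weighted_majority n w s"]
        prob_sym_diff_noise_weighted_majority[OF that, of n w s] by linarith
  qed
  then show "\<exists>C::real. \<forall>(n, M) \<in> weighted_majorities. \<forall>\<epsilon>\<in>{0<..<1}.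
      prob_diff_noise n \<epsilon> M \<le> C * \<epsilon> powr (1/4)"
    by (intro exI[of _ 3]) (auto simp: weighted_majorities_def)
qed

end
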